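(* Let $H_n$ be the cocktail party graph on $n \geq 4$ vertices, where $n$ is even. For any integer $k$ such that $2 < k < n$, $\mathcal{D}_k(H_n)$ is Eulerian if and only if $k$ is even.
   Context: All graphs are finite and simple. For an even integer $n \geq 4$, the cocktail party graph on $n$ vertices is the graph obtained by removing a perfect matching from the complete graph $K_n$. A dominating set of a graph $G$ is a set $D \subseteq V(G)$ such that every vertex of $V(G)\setminus D$ is adjacent to a vertex of $D$. The $k$-dominating graph $\mathcal{D}_k(G)$ is the graph whose vertices are the dominating sets of $G$ of cardinality at most $k$, two of them being adjacent if and only if one can be obtained from the other by adding or removing a single vertex of $G$. A graph is Eulerian if and only if every vertex has even degree and it contains at most one non-trivial component (a graph or component is trivial if it contains no edges). *)

theory Defs
  imports "Graph_Theory.Graph_Theory"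
begin

text \<open>
  Finite simple graphs are the \<^locale>\<open>pair_graph\<close>s, that is, finite symmetric loop-free relations.
  Each edge is represented by its two opposite arcs, so an edge set is a symmetric set of pairs.
\<close>

definition perfect_matching :: "'a pair_pre_digraph \<Rightarrow> ('a \<times> 'a) set \<Rightarrow> bool" where
  "perfect_matching G M \<longleftrightarrow>
     M \<subseteq> parcs G \<and> sym M \<and> (\<forall>u \<in> pverts G. \<exists>!v. (u, v) \<in> M)"

definition cocktail_party_graph :: "nat \<Rightarrow> 'a pair_pre_digraph \<Rightarrow> bool" where
  "cocktail_party_graph n H \<longleftrightarrow>
     (\<exists>K M. K\<^bsub>n\<^esub> (with_proj K) \<and> perfect_matching K M \<and>
        H = \<lparr> pverts = pverts K, parcs = parcs K - M \<rparr>)"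

definition dominating_set :: "'a pair_pre_digraph \<Rightarrow> 'a set \<Rightarrow> bool" where
  "dominating_set G D \<longleftrightarrow>
     D \<subseteq> pverts G \<and> (\<forall>v \<in> pverts G - D. \<exists>u \<in> D. (v, u) \<in> parcs G)"

definition k_dominating_graph :: "nat \<Rightarrow> 'a pair_pre_digraph \<Rightarrow> 'a set pair_pre_digraph" where
  "k_dominating_graph k G =
     (let V = {D. dominating_set G D \<and> card D \<le> k} in
      \<lparr> pverts = V,
        parcs = {(A, B). A \<in> V \<and> B \<in> V \<and>
          (\<exists>v \<in> pverts G. v \<notin> A \<and> B = insert v A \<or> v \<in> A \<and> B = A - {v})} \<rparr>)"

text \<open>
  In a \<^locale>\<open>pair_graph\<close> the number of arcs leaving a vertex is its degree, and
  the strongly connected components are the components.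
\<close>

definition eulerian :: "'a pair_pre_digraph \<Rightarrow> bool" where
  "eulerian G \<longleftrightarrow>
     (\<forall>v \<in> pverts G. even (out_degree (with_proj G) v)) \<and>
     (\<exists>\<^sub>\<le>\<^sub>1 C. C \<in> pre_digraph.sccs (with_proj G) \<and> arcs C \<noteq> {})"

lemma cocktail_party_graph_imp_pair_graph:
  assumes "cocktail_party_graph n H"
  shows "pair_graph H"
proof -
  obtain K M where K: "K\<^bsub>n\<^esub> (with_proj K)" and M: "perfect_matching K M"
    and H: "H = \<lparr> pverts = pverts K, parcs = parcs K - M \<rparr>"
    using assms unfolding cocktail_party_graph_def by blast
  interpret K: pair_graph K using K by (rule pair_graphI_complete)
  have "sym (parcs K)" using K.pair_sym_arcs by (simp add: symmetric_def)
  moreover have "sym M" using M by (simp add: perfect_matching_def)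
  ultimately have "sym (parcs K - M)" by (auto simp: sym_def)
  then show ?thesis unfolding H
    by unfold_locales
      (auto simp: symmetric_def K.pair_finite_verts K.pair_finite_arcs
        dest: K.in_arcsD1 K.in_arcsD2 K.pair_no_loops)
qed

lemma pair_graph_k_dominating_graph:
  assumes "pair_graph G"
  shows "pair_graph (k_dominating_graph k G)"
proof -
  interpret pair_graph G by fact
  define V where "V = {D. dominating_set G D \<and> card D \<le> k}"
  have V: "finite V"
    by (rule finite_subset[of _ "Pow (pverts G)"])
      (auto simp: V_def dominating_set_def pair_finite_verts)
  have verts: "pverts (k_dominating_graph k G) = V"
    by (simp add: k_dominating_graph_def V_def)
  have sub: "parcs (k_dominating_graph k G) \<subseteq> V \<times> V"
    by (auto simp: k_dominating_graph_def V_def)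
  have "sym (parcs (k_dominating_graph k G))"
    unfolding k_dominating_graph_def Let_def
    by (rule symI) (auto simp: insert_absorb)
  moreover have "fst e \<noteq> snd e" if "e \<in> parcs (k_dominating_graph k G)" for e
    using that unfolding k_dominating_graph_def Let_def by auto
  moreover have "finite (parcs (k_dominating_graph k G))"
    using sub V by (meson finite_SigmaI finite_subset)
  ultimately show ?thesis
    using V sub by unfold_locales (auto simp: verts symmetric_def)
qed

end

theory Submission
  imports Defs
begin

text \<open>
  The dominating sets of a cocktail party graph are exactly the vertex sets with at least two
  elements. Hence in the \<open>k\<close>-dominating graph, for \<open>2 < k < n\<close>, a set of size \<open>2\<close> has degree \<open>n - 2\<close>,
  a set of size strictly between \<open>2\<close> and \<open>k\<close> has degree \<open>n\<close>, and a set of size \<open>k\<close> has degree \<open>k\<close>.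
  As \<open>n\<close> is even, all degrees are even iff \<open>k\<close> is. The graph is connected: if \<open>A \<noteq> B\<close>, one can
  always add to \<open>A\<close> an element of \<open>B\<close> or delete from \<open>A\<close> an element outside \<open>B\<close>.
\<close>

lemma cocktail_party_graph_pverts:
  assumes "cocktail_party_graph n H"
  shows "finite (pverts H)" and "card (pverts H) = n"
  using assms by (auto simp: cocktail_party_graph_def complete_digraph_pair_def)

text \<open>Each vertex misses only itself and its partner under \<open>M\<close>. A single vertex
  therefore leaves its partner undominated, while of two distinct vertices at most one can be the
  partner of an outside vertex. The bound \<open>0 < n\<close> rules out the empty set as a
  dominating set.\<close>

lemma cocktail_party_graph_dominating_set_iff:
  assumes "cocktail_party_graph n H" and "0 < n"
  shows "dominating_set H D \<longleftrightarrow> D \<subseteq> pverts H \<and> 2 \<le> card D"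
proof -
  obtain K M where K: "K\<^bsub>n\<^esub> (with_proj K)" and M: "perfect_matching K M"
    and H: "H = \<lparr> pverts = pverts K, parcs = parcs K - M \<rparr>"
    using assms unfolding cocktail_party_graph_def by blast
  have fin: "finite (pverts K)" and card: "card (pverts K) = n"
    and arcs: "parcs K = {(u, v). (u, v) \<in> pverts K \<times> pverts K \<and> u \<noteq> v}"
    using K by (simp_all add: complete_digraph_pair_def)
  have sub: "M \<subseteq> parcs K" and "sym M" and match: "\<And>u. u \<in> pverts K \<Longrightarrow> \<exists>!v. (u, v) \<in> M"
    using M by (auto simp: perfect_matching_def)
  show ?thesis
  proof (intro iffI conjI; (elim conjE)?)
    assume D: "dominating_set H D"
    then show "D \<subseteq> pverts H" by (simp add: dominating_set_def)
    then have finD: "finite D" using fin H by (simp add: finite_subset)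
    show "2 \<le> card D"
    proof (rule ccontr)
      assume "\<not> 2 \<le> card D"
      then have "card D = 0 \<or> card D = 1" by linarith
      then show False
      proof
        assume "card D = 0"
        then show False
          using D finD H card \<open>0 < n\<close> by (auto simp: dominating_set_def)
      next
        assume "card D = 1"
        then obtain v where v: "D = {v}" by (rule card_1_singletonE)
        then have "v \<in> pverts K" using D H by (simp add: dominating_set_def)
        then obtain w where "(v, w) \<in> M" using match by blast
        then have "(w, v) \<in> M" using \<open>sym M\<close> by (auto dest: symD)
        then have "w \<in> pverts K" "w \<noteq> v" using sub arcs by auto
        then have "(w, v) \<in> parcs H" using D H v by (auto simp: dominating_set_def)
        then show False using \<open>(w, v) \<in> M\<close> H by simp
      qed
    qed
  next
    assume D: "D \<subseteq> pverts H" and "2 \<le> card D"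
    then obtain x y where xy: "x \<in> D" "y \<in> D" "x \<noteq> y"
      by (auto simp: card_le_Suc_iff numeral_2_eq_2)
    have "\<exists>u\<in>D. (v, u) \<in> parcs H" if v: "v \<in> pverts H - D" for v
    proof -
      have "(v, x) \<in> parcs K" "(v, y) \<in> parcs K" using v xy D H arcs by auto
      moreover have "\<not> ((v, x) \<in> M \<and> (v, y) \<in> M)" using match[of v] v xy H by auto
      ultimately show ?thesis using xy H by auto
    qed
    then show "dominating_set H D" using D by (simp add: dominating_set_def)
  qed
qed

text \<open>A neighbour of \<open>A\<close> determines the one vertex inserted or deleted, and no
  set arises in both ways, so the degree splits into two separate counts.\<close>

lemma out_degree_k_dominating_graph:
  fixes k :: nat and G :: "'a pair_pre_digraph"
  defines "V \<equiv> pverts (k_dominating_graph k G)"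
  assumes fin: "finite (pverts G)" and A: "A \<in> V"
  shows "out_degree (with_proj (k_dominating_graph k G)) A =
    card {v \<in> pverts G - A. insert v A \<in> V} + card {v \<in> A. A - {v} \<in> V}"
proof -
  let ?I = "{v \<in> pverts G - A. insert v A \<in> V}" and ?R = "{v \<in> A. A - {v} \<in> V}"
  have "A \<subseteq> pverts G"
    using A by (simp add: V_def k_dominating_graph_def dominating_set_def Let_def)
  then have finA: "finite A" using fin by (rule finite_subset)
  have "out_arcs (with_proj (k_dominating_graph k G)) A =
      (\<lambda>v. (A, insert v A)) ` ?I \<union> (\<lambda>v. (A, A - {v})) ` ?R"
    using A \<open>A \<subseteq> pverts G\<close> by (auto simp: out_arcs_def V_def k_dominating_graph_def Let_def)
  moreover have "card ((\<lambda>v. (A, insert v A)) ` ?I) = card ?I"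
    by (rule card_image) (auto simp: inj_on_def)
  moreover have "card ((\<lambda>v. (A, A - {v})) ` ?R) = card ?R"
    by (rule card_image) (auto simp: inj_on_def)
  moreover have "(\<lambda>v. (A, insert v A)) ` ?I \<inter> (\<lambda>v. (A, A - {v})) ` ?R = {}"
    by auto
  ultimately show ?thesis
    using fin finA by (simp add: out_degree_def card_Un_disjoint)
qed

text \<open>A component is maximal among mutually reachable vertex sets, so here it contains every
  vertex; as an induced subgraph it is determined by its vertices.\<close>

lemma (in wf_digraph) sccs_unique_if_strongly_connected:
  assumes "strongly_connected G" and "C \<in> sccs" and "D \<in> sccs"
  shows "C = D"
proof -
  have "verts E = verts G" if "E \<in> sccs" for E
  proof -
    have "verts E \<subseteq> verts G" and "verts E \<in> sccs_verts"
      using that by (auto simp: sccs_verts_conv)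
    moreover obtain u where "u \<in> verts E"
      using \<open>verts E \<in> sccs_verts\<close> by (auto simp: sccs_verts_def)
    ultimately show ?thesis
      using assms(1) unfolding sccs_verts_def strongly_connected_def by blast
  qed
  then show ?thesis using assms inj_on_verts_sccs by (metis inj_onD)
qed

lemma strongly_connected_k_dominating_graph:
  assumes fin: "finite (pverts G)" and "2 < k" and "k \<le> card (pverts G)"
    and dom: "\<And>D. dominating_set G D \<longleftrightarrow> D \<subseteq> pverts G \<and> 2 \<le> card D"
    and "pair_graph G"
  shows "strongly_connected (with_proj (k_dominating_graph k G))"
proof (rule strongly_connectedI)
  let ?Q = "k_dominating_graph k G"
  interpret Q: pair_graph ?Q using \<open>pair_graph G\<close> by (rule pair_graph_k_dominating_graph)
  have V: "D \<in> pverts ?Q \<longleftrightarrow> D \<subseteq> pverts G \<and> 2 \<le> card D \<and> card D \<le> k" for D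
    by (auto simp: k_dominating_graph_def dom)
  \<comment> \<open>Strong connectivity includes having a vertex, and any set of size
    \<open>k\<close> is one.\<close>
  obtain D where "D \<subseteq> pverts G" "card D = k"
    using \<open>k \<le> card (pverts G)\<close> by (rule obtain_subset_with_card_n)
  then show "verts (with_proj ?Q) \<noteq> {}" using V[of D] \<open>2 < k\<close> by auto
  fix A B assume "A \<in> verts (with_proj ?Q)" and "B \<in> verts (with_proj ?Q)"
  \<comment> \<open>The target \<open>B\<close> stays fixed while \<open>A\<close> moves; each move
    removes one vertex from the symmetric difference.\<close>
  then show "A \<rightarrow>\<^sup>*\<^bsub>with_proj ?Q\<^esub> B"
  proof (induction "card (sym_diff A B)" arbitrary: A rule: less_induct)
    case less
    then have A: "A \<in> pverts ?Q" and B: "B \<in> pverts ?Q" by simp_all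
    then have sub: "A \<subseteq> pverts G" "B \<subseteq> pverts G" and finA: "finite A" and finB: "finite B"
      using fin by (auto simp: V intro: finite_subset)
    have step: ?case if "C \<in> pverts ?Q" "(A, C) \<in> parcs ?Q" "sym_diff C B \<subset> sym_diff A B" for C
    proof -
      have "card (sym_diff C B) < card (sym_diff A B)"
        using that(3) finA finB by (intro psubset_card_mono) auto
      then have "C \<rightarrow>\<^sup>*\<^bsub>with_proj ?Q\<^esub> B" using less that by simp
      moreover have "A \<rightarrow>\<^bsub>with_proj ?Q\<^esub> C" using that(2) by simp
      ultimately show ?thesis by (rule wf_digraph.adj_reachable_trans[OF Q.wf_digraph_axioms, rotated])
    qed
    consider (eq) "A = B" | (add) b where "b \<in> B - A" "card A < k"
      | (del) a where "a \<in> A - B" "2 < card A"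
    proof (cases "card A < k \<and> \<not> B \<subseteq> A \<or> 2 < card A \<and> \<not> A \<subseteq> B")
      case False
      \<comment> \<open>No move is possible. If \<open>A\<close> lies in \<open>B\<close>, then
        either \<open>B\<close> lies in \<open>A\<close> or \<open>A\<close> already has the maximal
        size \<open>k\<close>. Otherwise deletion is blocked, so \<open>A\<close> has size 2; as
        \<open>2 < k\<close>, the blocked insertion means that \<open>B\<close> lies in
        \<open>A\<close>, and \<open>B\<close> has at least 2 elements.\<close>
      have "A = B"
      proof (cases "A \<subseteq> B")
        case True
        then show ?thesis
          using False A B finB \<open>2 < k\<close> by (intro card_subset_eq) (auto simp: V dest: card_mono)
      next
        case nsub: False
        then have "card A = 2" "B \<subseteq> A" using False A \<open>2 < k\<close> by (auto simp: V)
        then show ?thesis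
          using card_seteq[of A B] B finA by (auto simp: V)
      qed
      then show ?thesis by (rule that)
    qed (use that in blast)
    then show ?case
    proof cases
      case eq
      then show ?thesis using B by auto
    next
      case add
      then have C: "insert b A \<in> pverts ?Q" using A sub finA by (auto simp: V)
      show ?thesis
      proof (rule step[OF C])
        show "(A, insert b A) \<in> parcs ?Q"
          using add A C sub by (auto simp: k_dominating_graph_def Let_def)
      qed (use add in auto)
    next
      case del
      then have C: "A - {a} \<in> pverts ?Q" using A sub finA by (auto simp: V)
      show ?thesis
      proof (rule step[OF C])
        show "(A, A - {a}) \<in> parcs ?Q"
          using del A C sub by (auto simp: k_dominating_graph_def Let_def)
      qed (use del in auto)
    qed
  qed
qed

theorem theorem10:
  fixes H :: "'a pair_pre_digraph" and n k :: nat
  assumes "n \<ge> 4" and "even n"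
    and "cocktail_party_graph n H"
    and "2 < k" and "k < n"
  shows "eulerian (k_dominating_graph k H) \<longleftrightarrow> even k"
proof -
  let ?Q = "k_dominating_graph k H"
  have fin: "finite (pverts H)" and card: "card (pverts H) = n"
    using cocktail_party_graph_pverts assms(3) by blast+
  have dom: "dominating_set H D \<longleftrightarrow> D \<subseteq> pverts H \<and> 2 \<le> card D" for D
    using assms by (intro cocktail_party_graph_dominating_set_iff) auto
  have H: "pair_graph H" using assms(3) by (rule cocktail_party_graph_imp_pair_graph)
  interpret Q: pair_graph ?Q using H by (rule pair_graph_k_dominating_graph)
  have V: "D \<in> pverts ?Q \<longleftrightarrow> D \<subseteq> pverts H \<and> 2 \<le> card D \<and> card D \<le> k" for D
    by (auto simp: k_dominating_graph_def dom)
  have deg: "even (out_degree (with_proj ?Q) A) \<longleftrightarrow> card A < k \<or> even k"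
    if A: "A \<in> pverts ?Q" for A
  proof -
    have sub: "A \<subseteq> pverts H" and finA: "finite A"
      using A fin by (auto simp: V intro: finite_subset)
    \<comment> \<open>Insertion fails only at size \<open>k\<close> and deletion only at size 2; by
      \<open>2 < k\<close> no vertex of \<open>?Q\<close> is at both bounds.\<close>
    have "{v \<in> pverts H - A. insert v A \<in> pverts ?Q} = (if card A < k then pverts H - A else {})"
      using A sub finA by (auto simp: V)
    moreover have "{v \<in> A. A - {v} \<in> pverts ?Q} = (if 2 < card A then A else {})"
      using A sub finA by (auto simp: V)
    moreover have "card (pverts H - A) = n - card A"
      using card sub finA by (simp add: card_Diff_subset)
    ultimately have "out_degree (with_proj ?Q) A =
        (if card A < k then n - card A else 0) + (if 2 < card A then card A else 0)"
      using out_degree_k_dominating_graph[OF fin A] by simp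
    then show ?thesis
      using A assms by (auto simp: V)
  qed
  show ?thesis
  proof
    assume "eulerian ?Q"
    \<comment> \<open>The parity of \<open>k\<close> shows only in the degrees of sets of the
      maximal size.\<close>
    obtain A where "A \<subseteq> pverts H" "card A = k"
      using obtain_subset_with_card_n[of k "pverts H"] card \<open>k < n\<close> by auto
    then show "even k"
      using \<open>eulerian ?Q\<close> deg[of A] \<open>2 < k\<close> by (simp add: V eulerian_def)
  next
    assume "even k"
    \<comment> \<open>This leaves at most one component, hence at most one with arcs.\<close>
    have "strongly_connected (with_proj ?Q)"
      using strongly_connected_k_dominating_graph[OF fin _ _ dom H] assms card by simp
    then show "eulerian ?Q"
      using \<open>even k\<close> deg Q.sccs_unique_if_strongly_connected
      by (auto simp: eulerian_def Uniq_def)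
  qed
qed

end
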